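(* Let $q\in\mathbb{C}\setminus\{0\}$ and $\delta=q+q^{-1}$. The only finite dimensional representations of $TL_\infty(\delta)$ are direct sums of one-dimensional representations; that is, every finite dimensional representation of $TL_\infty(\delta)$ is a direct sum of one-dimensional representations.
   Context: $TL_\infty(\delta)$ is the unital associative $\mathbb{C}$-algebra generated by $\mathbf{1}$ and $e_i$, $i\in\mathbb{N}=\{1,2,3,\dots\}$, with relations $e_i^2=\delta e_i$, $e_ie_{i\pm1}e_i=e_i$, and $e_ie_j=e_je_i$ for $|i-j|>1$ (only finite products of generators and finite linear combinations are considered). Representations are over $\mathbb{C}$ and $\mathbf{1}$ acts as the identity. *)

theory Defs
  imports "HOL-Algebra.QuotRing" "HOL-Algebra.Module" "HOL-Library.Poly_Mapping" Complex_Main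
begin

text \<open>The free monoid, written additively because the convolution product on
  \<open>'m \<Rightarrow>\<^sub>0 complex\<close> is indexed by an additive (here non-commutative) monoid \<open>'m\<close>.
  Hence \<open>'x free_monoid \<Rightarrow>\<^sub>0 complex\<close> is the free unital associative \<open>\<complex>\<close>-algebra on \<open>'x\<close>.\<close>

datatype 'x free_monoid = Word (letters: "'x list")

instantiation free_monoid :: (type) monoid_add
begin

definition zero_free_monoid :: "'a free_monoid"
  where "0 = Word []"

definition plus_free_monoid :: "'a free_monoid \<Rightarrow> 'a free_monoid \<Rightarrow> 'a free_monoid"
  where "u + v = Word (letters u @ letters v)"

instance
  by standard (simp_all add: zero_free_monoid_def plus_free_monoid_def)

end

type_synonym 'x free_alg = "'x free_monoid \<Rightarrow>\<^sub>0 complex"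

definition scal :: "complex \<Rightarrow> 'x free_alg"
  where "scal c = Poly_Mapping.single 0 c"

text \<open>The letter \<open>i :: nat\<close>, counted from \<open>0\<close>, stands for the generator \<open>e\<^bsub>i+1\<^esub>\<close>; the
  relations depend on differences of indices only.\<close>

definition gen :: "nat \<Rightarrow> nat free_alg"
  where "gen i = Poly_Mapping.single (Word [i]) 1"

definition TL_relations :: "complex \<Rightarrow> nat free_alg set"
  where "TL_relations \<delta> =
      {gen i * gen i - scal \<delta> * gen i | i. True}
    \<union> {gen i * gen j * gen i - gen i | i j. \<bar>int i - int j\<bar> = 1}
    \<union> {gen i * gen j - gen j * gen i | i j. \<bar>int i - int j\<bar> > 1}"

definition free_TL_ring :: "nat free_alg ring"
  where "free_TL_ring = \<lparr>carrier = UNIV, mult = (*), one = 1, zero = 0, add = (+)\<rparr>"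

text \<open>The two-sided ideal generated by the relations.\<close>

definition TL_ideal :: "complex \<Rightarrow> nat free_alg set"
  where "TL_ideal \<delta> = Idl\<^bsub>free_TL_ring\<^esub> (TL_relations \<delta>)"

text \<open>The quotient ring, with the scalar multiplication induced by
  \<open>c \<cdot> x = scal c * x\<close> on the free algebra (see \<open>TL_smult_coset\<close>).\<close>

definition TL :: "complex \<Rightarrow> (complex, nat free_alg set) module"
  where "TL \<delta> = ring.extend (free_TL_ring Quot TL_ideal \<delta>)
    (module.fields (\<lambda>c X.
      (TL_ideal \<delta> +>\<^bsub>free_TL_ring\<^esub> scal c) \<otimes>\<^bsub>free_TL_ring Quot TL_ideal \<delta>\<^esub> X))"

definition TL_e :: "complex \<Rightarrow> nat \<Rightarrow> nat free_alg set"
  where "TL_e \<delta> i = TL_ideal \<delta> +>\<^bsub>free_TL_ring\<^esub> gen i"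

text \<open>Representations of a unital associative \<open>\<complex>\<close>-algebra, the unit acting as the identity.
  The type \<open>module\<close> is used as a plain record (a ring with a scalar multiplication), since
  the locale \<open>algebra\<close> of HOL-Algebra covers commutative algebras only.\<close>

locale algebra_rep = vector_space scale
  for scale :: "complex \<Rightarrow> 'v::ab_group_add \<Rightarrow> 'v" +
  fixes A :: "(complex, 'a) module" and \<rho> :: "'a \<Rightarrow> 'v \<Rightarrow> 'v"
  assumes rep_linear: "a \<in> carrier A \<Longrightarrow> Vector_Spaces.linear scale scale (\<rho> a)"
    and rep_add: "\<lbrakk>a \<in> carrier A; b \<in> carrier A\<rbrakk> \<Longrightarrow> \<rho> (a \<oplus>\<^bsub>A\<^esub> b) = (\<lambda>v. \<rho> a v + \<rho> b v)"
    and rep_smult: "a \<in> carrier A \<Longrightarrow> \<rho> (c \<odot>\<^bsub>A\<^esub> a) = (\<lambda>v. scale c (\<rho> a v))"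
    and rep_mult: "\<lbrakk>a \<in> carrier A; b \<in> carrier A\<rbrakk> \<Longrightarrow> \<rho> (a \<otimes>\<^bsub>A\<^esub> b) = \<rho> a \<circ> \<rho> b"
    and rep_one: "\<rho> \<one>\<^bsub>A\<^esub> = id"
begin

definition subrep :: "'v set \<Rightarrow> bool"
  where "subrep W \<longleftrightarrow> subspace W \<and> (\<forall>a\<in>carrier A. \<forall>w\<in>W. \<rho> a w \<in> W)"

text \<open>The empty family is allowed, so the zero representation is a direct sum.\<close>

definition direct_sum_of_subreps :: "'i set \<Rightarrow> ('i \<Rightarrow> 'v set) \<Rightarrow> bool"
  where "direct_sum_of_subreps I W \<longleftrightarrow>
    finite I \<and> (\<forall>i\<in>I. subrep (W i)) \<and>
    (\<forall>v. \<exists>!w. w \<in> (\<Pi>\<^sub>E i\<in>I. W i) \<and> v = (\<Sum>i\<in>I. w i))"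

end

lemma ring_free_TL_ring: "ring free_TL_ring"
proof -
  have "\<exists>y. x + y = 0 \<and> y + x = 0" for x :: "nat free_alg"
    by (rule exI[of _ "- x"]) simp
  then show ?thesis
    unfolding free_TL_ring_def by unfold_locales (auto simp: algebra_simps Units_def)
qed

lemma TL_ideal_ideal: "ideal (TL_ideal \<delta>) free_TL_ring"
proof -
  interpret F: ring free_TL_ring by (rule ring_free_TL_ring)
  show ?thesis
    unfolding TL_ideal_def by (rule F.genideal_ideal) (simp add: free_TL_ring_def)
qed

lemma TL_simps:
  "carrier (TL \<delta>) = carrier (free_TL_ring Quot TL_ideal \<delta>)"
  "mult (TL \<delta>) = mult (free_TL_ring Quot TL_ideal \<delta>)"
  "one (TL \<delta>) = one (free_TL_ring Quot TL_ideal \<delta>)"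
  "zero (TL \<delta>) = zero (free_TL_ring Quot TL_ideal \<delta>)"
  "add (TL \<delta>) = add (free_TL_ring Quot TL_ideal \<delta>)"
  by (simp_all add: TL_def ring.defs module.defs FactRing_def)

lemma TL_carrier: "carrier (TL \<delta>) = range (\<lambda>x. TL_ideal \<delta> +>\<^bsub>free_TL_ring\<^esub> x)"
  by (auto simp: TL_simps FactRing_def A_RCOSETS_def RCOSETS_def a_r_coset_def
      free_TL_ring_def)

lemma TL_coset_mult:
  "(TL_ideal \<delta> +>\<^bsub>free_TL_ring\<^esub> x) \<otimes>\<^bsub>TL \<delta>\<^esub> (TL_ideal \<delta> +>\<^bsub>free_TL_ring\<^esub> y)
    = TL_ideal \<delta> +>\<^bsub>free_TL_ring\<^esub> (x * y)"
  using ideal.rcoset_mult_add[OF TL_ideal_ideal, of x y]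
  by (simp add: TL_simps FactRing_def free_TL_ring_def)

lemma TL_smult_coset:
  "c \<odot>\<^bsub>TL \<delta>\<^esub> (TL_ideal \<delta> +>\<^bsub>free_TL_ring\<^esub> x) = TL_ideal \<delta> +>\<^bsub>free_TL_ring\<^esub> (scal c * x)"
  using TL_coset_mult[of \<delta> "scal c" x]
  by (simp add: TL_simps) (simp add: TL_def ring.defs module.defs FactRing_def)

lemma TL_coset_eqI:
  assumes "x - y \<in> TL_ideal \<delta>"
  shows "TL_ideal \<delta> +>\<^bsub>free_TL_ring\<^esub> x = TL_ideal \<delta> +>\<^bsub>free_TL_ring\<^esub> y"
proof -
  interpret F: ring free_TL_ring by (rule ring_free_TL_ring)
  interpret I: ideal "TL_ideal \<delta>" free_TL_ring by (rule TL_ideal_ideal)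
  have "x = (x - y) \<oplus>\<^bsub>free_TL_ring\<^esub> y" by (simp add: free_TL_ring_def)
  then have "x \<in> TL_ideal \<delta> +>\<^bsub>free_TL_ring\<^esub> y"
    using assms unfolding a_r_coset_def' by blast
  then show ?thesis
    using I.a_repr_independence'[of x y] by (simp add: free_TL_ring_def)
qed

lemma TL_relation_mem: "r \<in> TL_relations \<delta> \<Longrightarrow> r \<in> TL_ideal \<delta>"
  unfolding TL_ideal_def genideal_def by blast

lemma TL_e_square: "TL_e \<delta> i \<otimes>\<^bsub>TL \<delta>\<^esub> TL_e \<delta> i = \<delta> \<odot>\<^bsub>TL \<delta>\<^esub> TL_e \<delta> i"
  unfolding TL_e_def TL_coset_mult TL_smult_coset
  by (rule TL_coset_eqI, rule TL_relation_mem) (auto simp: TL_relations_def)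

lemma TL_e_neighbours:
  "\<bar>int i - int j\<bar> = 1 \<Longrightarrow> TL_e \<delta> i \<otimes>\<^bsub>TL \<delta>\<^esub> TL_e \<delta> j \<otimes>\<^bsub>TL \<delta>\<^esub> TL_e \<delta> i = TL_e \<delta> i"
  unfolding TL_e_def TL_coset_mult
  by (rule TL_coset_eqI, rule TL_relation_mem) (auto simp: TL_relations_def)

lemma TL_e_commute:
  "\<bar>int i - int j\<bar> > 1 \<Longrightarrow> TL_e \<delta> i \<otimes>\<^bsub>TL \<delta>\<^esub> TL_e \<delta> j = TL_e \<delta> j \<otimes>\<^bsub>TL \<delta>\<^esub> TL_e \<delta> i"
  unfolding TL_e_def TL_coset_mult
  by (rule TL_coset_eqI, rule TL_relation_mem) (auto simp: TL_relations_def)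

end

theory Submission
  imports Defs "HOL-Library.Function_Algebras"
begin

text \<open>Let \<open>E\<^sub>i\<close> be the operator by which the \<open>i\<close>-th generator acts on the finite-dimensional
  space \<open>V\<close>. Finite dimension enters through \<open>End V\<close>: the sequence \<open>E\<^sub>0, E\<^sub>1, \<dots>\<close> cannot be linearly
  independent there, so some \<open>E\<^sub>n\<close> is a linear combination of \<open>E\<^sub>0, \<dots>, E\<^bsub>n-1\<^esub>\<close>
  (\<open>in_span_of_predecessors\<close>, \<open>linear_maps_finitely_spanned\<close>). All of these are at distance at least
  two from \<open>E\<^bsub>n+1\<^esub>\<close>, hence commute with it, and so \<open>E\<^sub>n\<close> commutes with its neighbour \<open>E\<^bsub>n+1\<^esub>\<close>.
  Commuting neighbours are equal (\<open>commuting_neighbours_equal\<close>), and one equality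
  \<open>E\<^sub>n = E\<^bsub>n+1\<^esub>\<close> spreads along the chain in both directions: \<open>E\<^bsub>n+2\<^esub>\<close> commutes with \<open>E\<^sub>n\<close>, which is
  its neighbour \<open>E\<^bsub>n+1\<^esub>\<close>, and symmetrically below. So all generators act by one operator \<open>E\<close>
  (\<open>all_equal\<close>).

  The remaining relations are \<open>E\<^sup>2 = \<delta>E\<close> and \<open>E\<^sup>3 = E\<close>, whence \<open>\<delta>\<^sup>2E = E\<close>. Thus \<open>\<delta>E\<close> is idempotent,
  \<open>E\<close> is diagonalizable with eigenvalues among \<open>0\<close> and \<open>\<delta>\<close>, and each line spanned by
  an eigenvector is a subrepresentation. A basis of eigenvectors gives the decomposition.\<close>

section \<open>Linear dependence among endomorphisms\<close>

lemma (in vector_space) in_span_of_predecessors: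
  fixes x :: "nat \<Rightarrow> 'b"
  assumes "finite T" and "range x \<subseteq> span T"
  obtains n where "x n \<in> span (x ` {..<n})"
proof (rule ccontr)
  assume "\<not> thesis"
  then have new: "x n \<notin> span (x ` {..<n})" for n
    using that by blast
  have "independent (x ` {..<n}) \<and> card (x ` {..<n}) = n" for n
  proof (induction n)
    case (Suc n)
    have "x n \<notin> x ` {..<n}"
      using new[of n] span_superset[of "x ` {..<n}"] by blast
    then show ?case
      using Suc.IH new[of n] by (simp add: lessThan_Suc independent_insert)
  qed (simp add: independent_empty)
  moreover have "x ` {..<n} \<subseteq> span T" for n
    using assms(2) by auto
  ultimately have "n \<le> card T" for n
    using independent_span_bound[OF assms(1), of "x ` {..<n}"] by simp
  from this[of "Suc (card T)"] show False by simp
qed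

lemma (in vector_space) vector_space_pointwise:
  "vector_space (\<lambda>c f. (\<lambda>x. scale c (f x)) :: 'x \<Rightarrow> 'b)"
  by unfold_locales
    (simp_all add: fun_eq_iff plus_fun_def scale_right_distrib scale_left_distrib)

text \<open>The matrix units of a basis span the endomorphisms. The ambient space is that of all functions,
  so the pointwise operations and the library notion of span apply directly to endomorphisms.\<close>

lemma (in finite_dimensional_vector_space) linear_maps_finitely_spanned:
  obtains T :: "('b \<Rightarrow> 'b) set" where "finite T"
    and "\<And>f. Vector_Spaces.linear scale scale f
      \<Longrightarrow> f \<in> module.span (\<lambda>c f x. scale c (f x)) T"
proof -
  interpret F: vector_space "\<lambda>c f. (\<lambda>x. scale c (f x)) :: 'b \<Rightarrow> 'b"
    by (rule vector_space_pointwise)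
  define M where "M b b' = (\<lambda>v. scale (representation Basis v b) b')" for b b' :: 'b
  show thesis
  proof
    show "finite (case_prod M ` (Basis \<times> Basis))"
      using finite_Basis by blast
    fix f assume "Vector_Spaces.linear scale scale f"
    then interpret f: Vector_Spaces.linear scale scale f .
    have expand: "(\<Sum>b\<in>Basis. scale (representation Basis v b) b) = v" for v
      by (rule sum_representation_eq)
        (use independent_Basis span_Basis finite_Basis in auto)
    have apply_sum: "(\<Sum>x\<in>A. g x) v = (\<Sum>x\<in>A. g x v)"
      for A :: "'b set" and g :: "'b \<Rightarrow> 'b \<Rightarrow> 'b" and v
      by (induction A rule: infinite_finite_induct) simp_all
    have "f = (\<Sum>b\<in>Basis. \<Sum>b'\<in>Basis. (\<lambda>v. scale (representation Basis (f b) b') (M b b' v)))"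
    proof
      fix v
      have "f v = (\<Sum>b\<in>Basis. scale (representation Basis v b) (f b))"
        by (subst expand[of v, symmetric]) (simp add: f.sum f.scale)
      also have "\<dots> = (\<Sum>b\<in>Basis. scale (representation Basis v b)
          (\<Sum>b'\<in>Basis. scale (representation Basis (f b) b') b'))"
        by (simp add: expand)
      also have "\<dots> = (\<Sum>b\<in>Basis. \<Sum>b'\<in>Basis. scale (representation Basis (f b) b') (M b b' v))"
        by (simp add: M_def scale_sum_right mult.commute)
      finally show "f v = (\<Sum>b\<in>Basis. \<Sum>b'\<in>Basis.
          (\<lambda>v. scale (representation Basis (f b) b') (M b b' v))) v"
        by (simp add: apply_sum)
    qed
    also have "\<dots> \<in> F.span (case_prod M ` (Basis \<times> Basis))"
      by (intro F.span_sum F.span_scale F.span_base) auto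
    finally show "f \<in> F.span (case_prod M ` (Basis \<times> Basis))" .
  qed
qed

section \<open>Operators satisfying the Temperley--Lieb relations\<close>

text \<open>The part of the argument about operators refers to the relations alone, so it is kept apart from
  the quotient algebra; \<open>TL_rep_generators\<close> connects the two.\<close>

locale temperley_lieb_action = vector_space scale
  for scale :: "complex \<Rightarrow> 'v::ab_group_add \<Rightarrow> 'v" +
  fixes \<delta> :: complex and E :: "nat \<Rightarrow> 'v \<Rightarrow> 'v"
  assumes linear_E: "Vector_Spaces.linear scale scale (E i)"
    and E_square: "E i (E i v) = scale \<delta> (E i v)"
    and E_neighbours: "\<bar>int i - int j\<bar> = 1 \<Longrightarrow> E i (E j (E i v)) = E i v"
    and E_far: "\<bar>int i - int j\<bar> > 1 \<Longrightarrow> E i (E j v) = E j (E i v)"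
begin

text \<open>If \<open>E\<^sub>i\<close> and \<open>E\<^sub>j\<close> commute, the neighbour relations become \<open>E\<^sub>i = E\<^sub>i\<^sup>2E\<^sub>j = \<delta>E\<^sub>iE\<^sub>j\<close> and
  \<open>E\<^sub>j = \<delta>E\<^sub>iE\<^sub>j\<close>, whose right-hand sides agree.\<close>

lemma commuting_neighbours_equal:
  assumes "\<bar>int i - int j\<bar> = 1" and comm: "\<And>v. E i (E j v) = E j (E i v)"
  shows "E i = E j"
proof
  fix v
  interpret J: Vector_Spaces.linear scale scale "E j" by (rule linear_E)
  have "E i v = E i (E i (E j v))"
    using E_neighbours[OF assms(1)] comm by simp
  also have "\<dots> = E j (E j (E i v))"
    by (simp add: E_square comm J.scale)
  also have "\<dots> = E j v"
    using E_neighbours[of j i v] assms by (simp add: comm)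
  finally show "E i v = E j v" .
qed

text \<open>The last operator in a linear dependence commutes with its upper neighbour, because all earlier
  ones do; this forces one equality between neighbours, which then propagates up and down.\<close>

lemma all_equal:
  assumes "finite_dimensional_vector_space scale Basis"
  shows "E i = E j"
proof -
  interpret V: finite_dimensional_vector_space scale Basis by (rule assms)
  interpret F: vector_space "\<lambda>c f. (\<lambda>x. scale c (f x)) :: 'v \<Rightarrow> 'v"
    by (rule vector_space_pointwise)
  obtain T :: "('v \<Rightarrow> 'v) set" where T: "finite T"
      "\<And>f. Vector_Spaces.linear scale scale f \<Longrightarrow> f \<in> F.span T"
    using V.linear_maps_finitely_spanned by blast
  obtain n where n: "E n \<in> F.span (E ` {..<n})"
    by (rule F.in_span_of_predecessors[of T E]) (use T linear_E in auto)
  interpret S: Vector_Spaces.linear scale scale "E (Suc n)" by (rule linear_E)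
  (* the commutant of E (Suc n) is a subspace containing every E i with i < n *)
  have "\<forall>v. E n (E (Suc n) v) = E (Suc n) (E n v)"
    using n
  proof (rule F.span_induct)
    show "F.subspace {f. \<forall>v. f (E (Suc n) v) = E (Suc n) (f v)}"
      by (simp add: F.subspace_def S.zero S.add S.scale)
  qed (auto intro: E_far)
  then have equal_n: "E n = E (Suc n)"
    by (intro commuting_neighbours_equal) auto
  have up: "E (Suc m) = E (Suc (Suc m))" if "E m = E (Suc m)" for m
    by (rule commuting_neighbours_equal)
      (use that E_far[of m "Suc (Suc m)"] in auto)
  have down: "E m = E (Suc m)" if "E (Suc m) = E (Suc (Suc m))" for m
    by (rule commuting_neighbours_equal)
      (use that E_far[of m "Suc (Suc m)"] in auto)
  have step: "E m = E (Suc m)" for m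
  proof (cases "m \<le> n")
    case True
    then show ?thesis
      by (induction m rule: inc_induct) (use equal_n down in blast)+
  next
    case False
    then have "n \<le> m" by simp
    then show ?thesis
      by (induction m rule: dec_induct) (use equal_n up in blast)+
  qed
  have "E m = E 0" for m
    by (induction m) (use step in auto)
  then show ?thesis by metis
qed

text \<open>Writing \<open>E\<close> for the common operator, \<open>v = (v - \<delta>Ev) + \<delta>Ev\<close> splits any vector into
  eigenvectors for \<open>0\<close> and \<open>\<delta>\<close>, so the eigenvectors span and contain a basis.\<close>

lemma basis_of_common_eigenvectors:
  assumes "finite_dimensional_vector_space scale Basis"
  obtains B where "finite B" "independent B" "span B = UNIV"
    and "\<And>b. b \<in> B \<Longrightarrow> \<exists>c. \<forall>i. E i b = scale c b"
proof -
  interpret V: finite_dimensional_vector_space scale Basis by (rule assms)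
  interpret L: Vector_Spaces.linear scale scale "E 0" by (rule linear_E)
  have E_eq: "E i = E 0" for i
    using assms by (rule all_equal)
  have unit: "scale \<delta> (scale \<delta> (E 0 v)) = E 0 v" for v
    using E_neighbours[of 0 1 v] E_eq[of 1] by (simp add: E_square L.scale)
  define S where "S = {v. \<exists>c. E 0 v = scale c v}"
  have "v \<in> span S" for v
  proof -
    have "E 0 (v - scale \<delta> (E 0 v)) = scale 0 (v - scale \<delta> (E 0 v))"
      by (simp add: L.diff L.scale E_square unit del: scale_scale)
    moreover have "E 0 (scale \<delta> (E 0 v)) = scale \<delta> (scale \<delta> (E 0 v))"
      by (simp add: L.scale E_square)
    ultimately have "(v - scale \<delta> (E 0 v)) + scale \<delta> (E 0 v) \<in> span S"
      unfolding S_def by (intro span_add span_base) blast+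
    then show ?thesis by simp
  qed
  moreover obtain B where B: "B \<subseteq> S" "independent B" "S \<subseteq> span B"
    using maximal_independent_subset by blast
  ultimately have "span B = UNIV"
    using span_minimal[OF B(3) subspace_span] by blast
  moreover have "finite B"
    using B(2) by (rule V.finiteI_independent)
  moreover have "\<exists>c. \<forall>i. E i b = scale c b" if "b \<in> B" for b
  proof -
    obtain c where "E 0 b = scale c b"
      using B(1) \<open>b \<in> B\<close> by (auto simp: S_def)
    then have "E i b = scale c b" for i
      using E_eq[of i] by simp
    then show ?thesis by blast
  qed
  ultimately show thesis
    using B(2) that by blast
qed

end

section \<open>Passing between the algebra and its generators\<close>

lemma (in algebra_rep) direct_sum_of_basis_lines:
  assumes "finite I" "inj_on b I" "independent (b ` I)" "span (b ` I) = UNIV"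
    and "\<And>i. i \<in> I \<Longrightarrow> subrep (span {b i})"
  shows "direct_sum_of_subreps I (\<lambda>i. span {b i})"
  unfolding direct_sum_of_subreps_def
proof (intro conjI ballI allI)
  fix v
  define coord where "coord = representation (b ` I)"
  define w where "w = (\<lambda>i\<in>I. scale (coord v (b i)) (b i))"
  have "(\<Sum>i\<in>I. w i) = (\<Sum>x\<in>b ` I. scale (coord v x) x)"
    using assms(2) by (simp add: w_def sum.reindex)
  also have "\<dots> = v"
    unfolding coord_def by (rule sum_representation_eq) (use assms in auto)
  finally have w_sum: "v = (\<Sum>i\<in>I. w i)" by simp
  show "\<exists>!w. w \<in> (\<Pi>\<^sub>E i\<in>I. span {b i}) \<and> v = (\<Sum>i\<in>I. w i)"
  proof (rule ex1I[of _ w], intro conjI)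
    show "w \<in> (\<Pi>\<^sub>E i\<in>I. span {b i})"
      by (auto simp: w_def intro!: span_scale[OF span_base])
    show "v = (\<Sum>i\<in>I. w i)" by (fact w_sum)
  next
    fix u assume u: "u \<in> (\<Pi>\<^sub>E i\<in>I. span {b i}) \<and> v = (\<Sum>i\<in>I. u i)"
    then have "\<forall>i\<in>I. \<exists>c. u i = scale c (b i)"
      by (auto simp: span_singleton PiE_iff)
    then obtain c where c: "\<And>i. i \<in> I \<Longrightarrow> u i = scale (c i) (b i)"
      by metis
    (* taking coordinates of v recovers the coefficients of any decomposition *)
    have "coord v (b i) = c i" if "i \<in> I" for i
    proof -
      have "coord v (b i) = (\<Sum>j\<in>I. coord (u j) (b i))"
        unfolding coord_def using u assms(3,4) by (simp add: representation_sum)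
      also have "\<dots> = (\<Sum>j\<in>I. if j = i then c j else 0)"
        unfolding coord_def using that assms(2,3,4)
        by (intro sum.cong)
          (auto simp: c representation_scale representation_basis inj_on_eq_iff)
      also have "\<dots> = c i"
        using that assms(1) by simp
      finally show ?thesis .
    qed
    then show "u = w"
      using u c by (auto simp: w_def PiE_iff extensional_def fun_eq_iff)
  qed
qed (use assms in auto)

lemma TL_coset_add:
  "(TL_ideal \<delta> +>\<^bsub>free_TL_ring\<^esub> x) \<oplus>\<^bsub>TL \<delta>\<^esub> (TL_ideal \<delta> +>\<^bsub>free_TL_ring\<^esub> y)
    = TL_ideal \<delta> +>\<^bsub>free_TL_ring\<^esub> (x + y)"
proof -
  interpret ideal "TL_ideal \<delta>" free_TL_ring by (rule TL_ideal_ideal)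
  show ?thesis
    using a_rcos_sum[of x y] by (simp add: TL_simps FactRing_def free_TL_ring_def)
qed

lemma TL_one: "\<one>\<^bsub>TL \<delta>\<^esub> = TL_ideal \<delta> +>\<^bsub>free_TL_ring\<^esub> 1"
  by (simp add: TL_simps FactRing_def free_TL_ring_def)

text \<open>Every element of the algebra is the class of a linear combination of words, and a word acts as a
  composition of generators; invariance under the generators is therefore enough.\<close>

lemma TL_subrepI:
  assumes "algebra_rep scale (TL \<delta>) \<rho>" and "module.subspace scale W"
    and gens: "\<And>i w. w \<in> W \<Longrightarrow> \<rho> (TL_e \<delta> i) w \<in> W"
  shows "algebra_rep.subrep scale (TL \<delta>) \<rho> W"
proof -
  interpret algebra_rep scale "TL \<delta>" \<rho> by (rule assms(1))
  define cl where "cl x = TL_ideal \<delta> +>\<^bsub>free_TL_ring\<^esub> x" for x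
  have carrier: "cl x \<in> carrier (TL \<delta>)" for x
    by (simp add: cl_def TL_carrier)
  have word: "\<rho> (cl (Poly_Mapping.single (Word ws) 1)) w \<in> W" if "w \<in> W" for ws w
  proof (induction ws)
    case Nil
    have "cl (Poly_Mapping.single (Word []) 1) = \<one>\<^bsub>TL \<delta>\<^esub>"
      by (simp add: cl_def TL_one flip: zero_free_monoid_def)
    then show ?case
      using that by (simp add: rep_one)
  next
    case (Cons i ws)
    have "Poly_Mapping.single (Word (i # ws)) 1 = gen i * Poly_Mapping.single (Word ws) 1"
      by (simp add: gen_def mult_single plus_free_monoid_def)
    then have "cl (Poly_Mapping.single (Word (i # ws)) 1)
        = TL_e \<delta> i \<otimes>\<^bsub>TL \<delta>\<^esub> cl (Poly_Mapping.single (Word ws) 1)"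
      by (simp add: cl_def TL_e_def TL_coset_mult)
    moreover have "TL_e \<delta> i \<in> carrier (TL \<delta>)"
      by (simp add: TL_e_def TL_carrier)
    ultimately show ?case
      using Cons carrier gens by (simp add: rep_mult)
  qed
  have "\<rho> (cl x) w \<in> W" if "w \<in> W" for x w
  proof (induction x rule: Poly_Mapping.update_induct)
    case const
    have "cl 0 = 0 \<odot>\<^bsub>TL \<delta>\<^esub> cl 0"
      by (simp add: cl_def TL_smult_coset)
    then have "\<rho> (cl 0) w = 0"
      using rep_smult[OF carrier, of 0 0] by simp
    then show ?case
      using subspace_0[OF assms(2)] by simp
  next
    case (update f k a)
    obtain ws where k: "k = Word ws" by (cases k)
    have "Poly_Mapping.update k a f = scal a * Poly_Mapping.single k 1 + f"
      using update.hyps(1)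
      by (intro poly_mapping_eqI)
        (auto simp: lookup_update lookup_add scal_def mult_single lookup_single in_keys_iff)
    then have "cl (Poly_Mapping.update k a f)
        = (a \<odot>\<^bsub>TL \<delta>\<^esub> cl (Poly_Mapping.single k 1)) \<oplus>\<^bsub>TL \<delta>\<^esub> cl f"
      by (simp add: cl_def TL_smult_coset TL_coset_add)
    moreover have "a \<odot>\<^bsub>TL \<delta>\<^esub> cl x \<in> carrier (TL \<delta>)" for x
      by (simp add: cl_def TL_smult_coset TL_carrier)
    ultimately have "\<rho> (cl (Poly_Mapping.update k a f)) w
        = scale a (\<rho> (cl (Poly_Mapping.single k 1)) w) + \<rho> (cl f) w"
      using carrier by (simp add: rep_add rep_smult)
    then show ?case
      using word[OF that] update.IH assms(2) by (simp add: k subspace_add subspace_scale)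
  qed
  then show ?thesis
    unfolding subrep_def using assms(2) by (auto simp: TL_carrier cl_def)
qed

lemma TL_rep_generators:
  assumes "algebra_rep scale (TL \<delta>) \<rho>"
  shows "temperley_lieb_action scale \<delta> (\<lambda>i. \<rho> (TL_e \<delta> i))"
proof -
  interpret algebra_rep scale "TL \<delta>" \<rho> by (rule assms)
  have e: "TL_e \<delta> i \<in> carrier (TL \<delta>)" for i
    by (simp add: TL_e_def TL_carrier)
  have ee: "TL_e \<delta> i \<otimes>\<^bsub>TL \<delta>\<^esub> TL_e \<delta> j \<in> carrier (TL \<delta>)" for i j
    by (simp add: TL_e_def TL_carrier TL_coset_mult)
  show ?thesis
  proof (intro temperley_lieb_action.intro temperley_lieb_action_axioms.intro)
    show "vector_space scale" by unfold_locales
  next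
    show "Vector_Spaces.linear scale scale (\<rho> (TL_e \<delta> i))" for i
      using e by (rule rep_linear)
  next
    fix i v
    have "\<rho> (TL_e \<delta> i \<otimes>\<^bsub>TL \<delta>\<^esub> TL_e \<delta> i) v = \<rho> (\<delta> \<odot>\<^bsub>TL \<delta>\<^esub> TL_e \<delta> i) v"
      by (simp only: TL_e_square)
    then show "\<rho> (TL_e \<delta> i) (\<rho> (TL_e \<delta> i) v) = scale \<delta> (\<rho> (TL_e \<delta> i) v)"
      using e by (simp add: rep_mult rep_smult)
  next
    fix i j v assume "\<bar>int i - int j\<bar> = 1"
    then have "\<rho> (TL_e \<delta> i \<otimes>\<^bsub>TL \<delta>\<^esub> TL_e \<delta> j \<otimes>\<^bsub>TL \<delta>\<^esub> TL_e \<delta> i) v = \<rho> (TL_e \<delta> i) v"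
      by (simp only: TL_e_neighbours)
    then show "\<rho> (TL_e \<delta> i) (\<rho> (TL_e \<delta> j) (\<rho> (TL_e \<delta> i) v)) = \<rho> (TL_e \<delta> i) v"
      using e ee by (simp add: rep_mult)
  next
    fix i j v assume "\<bar>int i - int j\<bar> > 1"
    then have "\<rho> (TL_e \<delta> i \<otimes>\<^bsub>TL \<delta>\<^esub> TL_e \<delta> j) v = \<rho> (TL_e \<delta> j \<otimes>\<^bsub>TL \<delta>\<^esub> TL_e \<delta> i) v"
      by (simp only: TL_e_commute)
    then show "\<rho> (TL_e \<delta> i) (\<rho> (TL_e \<delta> j) v) = \<rho> (TL_e \<delta> j) (\<rho> (TL_e \<delta> i) v)"
      using e by (simp add: rep_mult)
  qed
qed

theorem theorem3p1:
  fixes q \<delta> :: complex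
    and scale :: "complex \<Rightarrow> 'v::ab_group_add \<Rightarrow> 'v"
    and \<rho> :: "nat free_alg set \<Rightarrow> 'v \<Rightarrow> 'v"
  assumes "q \<noteq> 0" and "\<delta> = q + inverse q"
    and "algebra_rep scale (TL \<delta>) \<rho>"
    and "\<exists>Basis. finite_dimensional_vector_space scale Basis"
  shows "\<exists>(n::nat) L. algebra_rep.direct_sum_of_subreps scale (TL \<delta>) \<rho> {..<n} L
      \<and> (\<forall>i<n. vector_space.dim scale (L i) = 1)"
proof -
  interpret algebra_rep scale "TL \<delta>" \<rho> by (rule assms(3))
  interpret A: temperley_lieb_action scale \<delta> "\<lambda>i. \<rho> (TL_e \<delta> i)"
    using assms(3) by (rule TL_rep_generators)
  obtain Basis where "finite_dimensional_vector_space scale Basis"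
    using assms(4) by blast
  then obtain B where B: "finite B" "independent B" "span B = UNIV"
    and eigen: "\<And>b. b \<in> B \<Longrightarrow> \<exists>c. \<forall>i. \<rho> (TL_e \<delta> i) b = scale c b"
    using A.basis_of_common_eigenvectors by blast
  obtain b where "bij_betw b {0..<card B} B"
    using ex_bij_betw_nat_finite[OF B(1)] by blast
  then have b: "inj_on b {..<card B}" "b ` {..<card B} = B"
    by (auto simp: bij_betw_def atLeast0LessThan)
  have "subrep (span {x})" if "x \<in> B" for x
  proof (rule TL_subrepI[OF assms(3) subspace_span])
    fix i w assume "w \<in> span {x}"
    then obtain k where w: "w = scale k x" by (auto simp: span_singleton)
    interpret E: Vector_Spaces.linear scale scale "\<rho> (TL_e \<delta> i)"
      by (rule A.linear_E)
    obtain c where "\<rho> (TL_e \<delta> i) x = scale c x" using eigen[OF \<open>x \<in> B\<close>] by blast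
    then show "\<rho> (TL_e \<delta> i) w \<in> span {x}"
      by (auto simp: w E.scale simp del: scale_scale intro!: span_scale[OF span_scale[OF span_base]])
  qed
  then have "direct_sum_of_subreps {..<card B} (\<lambda>i. span {b i})"
    using B b by (intro direct_sum_of_basis_lines) auto
  moreover have "dim (span {b i}) = 1" if "i < card B" for i
  proof -
    have "independent {b i}"
      using b(2) that by (intro independent_mono[OF B(2)]) auto
    then show ?thesis
      using dim_eq_card_independent[of "{b i}"] by simp
  qed
  ultimately show ?thesis by blast
qed

end
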